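(* Let $C$ be a distributive category and $P:C\to C$ a bimonoidal functor such that there is a natural isomorphism $P^2\simeq P$. Then $(C,P)$ is a Rota-Baxter category of weight $-1$.
   Context: A distributive category is a category $C$ with functors $\oplus,\otimes:C\times C\to C$ and objects $0,1$ such that $(C,\oplus,0)$ is symmetric monoidal, $(C,\otimes,1)$ is monoidal, and there are natural isomorphisms $x\otimes(y\oplus z)\simeq(x\otimes y)\oplus(x\otimes z)$ and $(x\oplus y)\otimes z\simeq(x\otimes z)\oplus(y\otimes z)$. It has negative objects if it comes with a functor $-:C\to C$ and natural isomorphisms $-(x\oplus y)\simeq -x\oplus -y$, $-0\simeq 0$, $-(-x)\simeq x$. A functor $P:C\to C$ is additive if there are natural isomorphisms $P(x\oplus y)\simeq P(x)\oplus P(y)$ (and $P(-x)\simeq -P(x)$ if $C$ has a negative functor). $P$ is bimonoidal if it is additive and in addition there are natural isomorphisms $P(x\otimes y)\simeq P(x)\otimes P(y)$. A Rota-Baxter category of weight $-1$ is a distributive category $C$ with an additive functor $P:C\to C$ and natural isomorphisms $P(x)\otimes P(y)\oplus P(x\otimes y)\simeq P(P(x)\otimes y)\oplus P(x\otimes P(y))$. *)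

theory Defs
  imports Main
begin

record ('o, 'a) category_data =
  Obj :: "'o set"
  Arr :: "'a set"
  Dom :: "'a \<Rightarrow> 'o"
  Cod :: "'a \<Rightarrow> 'o"
  Ident :: "'o \<Rightarrow> 'a"
  Comp :: "'a \<Rightarrow> 'a \<Rightarrow> 'a"  (infixr \<open>\<cdot>\<index>\<close> 75)

text \<open>Composition is in the applicative order: \<open>g \<cdot> f\<close> is ``\<open>g\<close> after \<open>f\<close>''.\<close>

definition hom :: "('o, 'a) category_data \<Rightarrow> 'o \<Rightarrow> 'o \<Rightarrow> 'a set" where
  "hom C x y = {f \<in> Arr C. Dom C f = x \<and> Cod C f = y}"

locale category =
  fixes C :: "('o, 'a) category_data" (structure)
  assumes Dom_closed: "f \<in> Arr C \<Longrightarrow> Dom C f \<in> Obj C"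
    and Cod_closed: "f \<in> Arr C \<Longrightarrow> Cod C f \<in> Obj C"
    and Ident_hom: "x \<in> Obj C \<Longrightarrow> Ident C x \<in> hom C x x"
    and Comp_hom: "f \<in> hom C x y \<Longrightarrow> g \<in> hom C y z \<Longrightarrow> g \<cdot> f \<in> hom C x z"
    and Comp_Ident: "f \<in> hom C x y \<Longrightarrow> f \<cdot> Ident C x = f"
    and Ident_Comp: "f \<in> hom C x y \<Longrightarrow> Ident C y \<cdot> f = f"
    and Comp_assoc:
      "f \<in> hom C w x \<Longrightarrow> g \<in> hom C x y \<Longrightarrow> h \<in> hom C y z \<Longrightarrow> (h \<cdot> g) \<cdot> f = h \<cdot> (g \<cdot> f)"

definition isomorphism :: "('o, 'a) category_data \<Rightarrow> 'a \<Rightarrow> bool" where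
  "isomorphism C f \<longleftrightarrow> f \<in> Arr C \<and>
     (\<exists>g \<in> hom C (Cod C f) (Dom C f).
        g \<cdot>\<^bsub>C\<^esub> f = Ident C (Dom C f) \<and> f \<cdot>\<^bsub>C\<^esub> g = Ident C (Cod C f))"

definition isomorphic_objects :: "('o, 'a) category_data \<Rightarrow> 'o \<Rightarrow> 'o \<Rightarrow> bool" where
  "isomorphic_objects C x y \<longleftrightarrow> (\<exists>f \<in> hom C x y. isomorphism C f)"

definition product_category ::
    "('o, 'a) category_data \<Rightarrow> ('p, 'b) category_data \<Rightarrow> ('o \<times> 'p, 'a \<times> 'b) category_data"
    (infixr \<open>\<times>\<^sub>C\<close> 70) where
  "C \<times>\<^sub>C D =
     \<lparr>Obj = Obj C \<times> Obj D,
      Arr = Arr C \<times> Arr D,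
      Dom = map_prod (Dom C) (Dom D),
      Cod = map_prod (Cod C) (Cod D),
      Ident = map_prod (Ident C) (Ident D),
      Comp = (\<lambda>(g, g') (f, f'). (g \<cdot>\<^bsub>C\<^esub> f, g' \<cdot>\<^bsub>D\<^esub> f'))\<rparr>"

record ('o, 'a, 'p, 'b) functor_data =
  on_obj :: "'o \<Rightarrow> 'p"
  on_arr :: "'a \<Rightarrow> 'b"

locale category_functor = B: category B + C: category C
  for B :: "('o, 'a) category_data" and C :: "('p, 'b) category_data" +
  fixes F :: "('o, 'a, 'p, 'b) functor_data"
  assumes on_obj_closed: "x \<in> Obj B \<Longrightarrow> on_obj F x \<in> Obj C"
    and on_arr_hom: "f \<in> hom B x y \<Longrightarrow> on_arr F f \<in> hom C (on_obj F x) (on_obj F y)"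
    and on_arr_Ident: "x \<in> Obj B \<Longrightarrow> on_arr F (Ident B x) = Ident C (on_obj F x)"
    and on_arr_Comp: "f \<in> hom B x y \<Longrightarrow> g \<in> hom B y z \<Longrightarrow>
      on_arr F (g \<cdot>\<^bsub>B\<^esub> f) = on_arr F g \<cdot>\<^bsub>C\<^esub> on_arr F f"

locale natural_isomorphism =
  F: category_functor B C F + G: category_functor B C G
  for B :: "('o, 'a) category_data" and C :: "('p, 'b) category_data"
    and F G :: "('o, 'a, 'p, 'b) functor_data" +
  fixes \<tau> :: "'o \<Rightarrow> 'b"
  assumes component_hom: "x \<in> Obj B \<Longrightarrow> \<tau> x \<in> hom C (on_obj F x) (on_obj G x)"
    and component_iso: "x \<in> Obj B \<Longrightarrow> isomorphism C (\<tau> x)"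
    and naturality: "f \<in> hom B x y \<Longrightarrow> \<tau> y \<cdot>\<^bsub>C\<^esub> on_arr F f = on_arr G f \<cdot>\<^bsub>C\<^esub> \<tau> x"

definition naturally_isomorphic ::
    "('o, 'a) category_data \<Rightarrow> ('p, 'b) category_data \<Rightarrow>
     ('o, 'a, 'p, 'b) functor_data \<Rightarrow> ('o, 'a, 'p, 'b) functor_data \<Rightarrow> bool" where
  "naturally_isomorphic B C F G \<longleftrightarrow> (\<exists>\<tau>. natural_isomorphism B C F G \<tau>)"

definition id_functor :: "('o, 'a, 'o, 'a) functor_data" where
  "id_functor = \<lparr>on_obj = (\<lambda>x. x), on_arr = (\<lambda>f. f)\<rparr>"

definition const_functor :: "('p, 'b) category_data \<Rightarrow> 'p \<Rightarrow> ('o, 'a, 'p, 'b) functor_data" where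
  "const_functor C c = \<lparr>on_obj = (\<lambda>_. c), on_arr = (\<lambda>_. Ident C c)\<rparr>"

definition comp_functor ::
    "('p, 'b, 'q, 'c) functor_data \<Rightarrow> ('o, 'a, 'p, 'b) functor_data \<Rightarrow>
     ('o, 'a, 'q, 'c) functor_data"  (infixr \<open>\<circ>\<^sub>F\<close> 80) where
  "G \<circ>\<^sub>F F = \<lparr>on_obj = (\<lambda>x. on_obj G (on_obj F x)), on_arr = (\<lambda>f. on_arr G (on_arr F f))\<rparr>"

definition pair_functor ::
    "('o, 'a, 'p, 'b) functor_data \<Rightarrow> ('o, 'a, 'q, 'c) functor_data \<Rightarrow>
     ('o, 'a, 'p \<times> 'q, 'b \<times> 'c) functor_data" where
  "pair_functor F G =
     \<lparr>on_obj = (\<lambda>x. (on_obj F x, on_obj G x)), on_arr = (\<lambda>f. (on_arr F f, on_arr G f))\<rparr>"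

text \<open>
  An expression in the variables \<open>x, y, z\<close> that is functorial in each of them denotes a functor
  on a power of the category.  Such functors are built below from the projections, which play the
  role of the variables; this gives the action on objects and on arrows at the same time.
\<close>

definition fst_functor :: "('o \<times> 'p, 'a \<times> 'b, 'o, 'a) functor_data" where
  "fst_functor = \<lparr>on_obj = fst, on_arr = fst\<rparr>"

definition snd_functor :: "('o \<times> 'p, 'a \<times> 'b, 'p, 'b) functor_data" where
  "snd_functor = \<lparr>on_obj = snd, on_arr = snd\<rparr>"

abbreviation var1_of_2 :: "('o \<times> 'o, 'a \<times> 'a, 'o, 'a) functor_data" where
  "var1_of_2 \<equiv> fst_functor"

abbreviation var2_of_2 :: "('o \<times> 'o, 'a \<times> 'a, 'o, 'a) functor_data" where
  "var2_of_2 \<equiv> snd_functor"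

abbreviation var1_of_3 :: "('o \<times> 'o \<times> 'o, 'a \<times> 'a \<times> 'a, 'o, 'a) functor_data" where
  "var1_of_3 \<equiv> fst_functor"

abbreviation var2_of_3 :: "('o \<times> 'o \<times> 'o, 'a \<times> 'a \<times> 'a, 'o, 'a) functor_data" where
  "var2_of_3 \<equiv> fst_functor \<circ>\<^sub>F snd_functor"

abbreviation var3_of_3 :: "('o \<times> 'o \<times> 'o, 'a \<times> 'a \<times> 'a, 'o, 'a) functor_data" where
  "var3_of_3 \<equiv> snd_functor \<circ>\<^sub>F snd_functor"

record ('o, 'a) monoidal_data =
  tensor :: "('o \<times> 'o, 'a \<times> 'a, 'o, 'a) functor_data"
  unit_obj :: "'o"
  associator :: "'o \<times> 'o \<times> 'o \<Rightarrow> 'a"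
  left_unitor :: "'o \<Rightarrow> 'a"
  right_unitor :: "'o \<Rightarrow> 'a"

record ('o, 'a) symmetric_monoidal_data = "('o, 'a) monoidal_data" +
  braiding :: "'o \<times> 'o \<Rightarrow> 'a"

definition tensor_functor ::
    "('o, 'a, 'm) monoidal_data_scheme \<Rightarrow> ('p, 'b, 'o, 'a) functor_data \<Rightarrow>
     ('p, 'b, 'o, 'a) functor_data \<Rightarrow> ('p, 'b, 'o, 'a) functor_data" where
  "tensor_functor M F G = tensor M \<circ>\<^sub>F pair_functor F G"

locale monoidal_category = category C
  for C :: "('o, 'a) category_data" (structure) +
  fixes M :: "('o, 'a, 'm) monoidal_data_scheme"
  assumes tensor_is_functor: "category_functor (C \<times>\<^sub>C C) C (tensor M)"
    and unit_obj_closed: "unit_obj M \<in> Obj C"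
    and associator_natural: "natural_isomorphism (C \<times>\<^sub>C C \<times>\<^sub>C C) C
      (tensor_functor M (tensor_functor M var1_of_3 var2_of_3) var3_of_3)
      (tensor_functor M var1_of_3 (tensor_functor M var2_of_3 var3_of_3))
      (associator M)"
    and left_unitor_natural: "natural_isomorphism C C
      (tensor_functor M (const_functor C (unit_obj M)) id_functor) id_functor (left_unitor M)"
    and right_unitor_natural: "natural_isomorphism C C
      (tensor_functor M id_functor (const_functor C (unit_obj M))) id_functor (right_unitor M)"
    and pentagon: "w \<in> Obj C \<Longrightarrow> x \<in> Obj C \<Longrightarrow> y \<in> Obj C \<Longrightarrow> z \<in> Obj C \<Longrightarrow>
      associator M (w, x, on_obj (tensor M) (y, z)) \<cdot>
        associator M (on_obj (tensor M) (w, x), y, z) =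
      on_arr (tensor M) (Ident C w, associator M (x, y, z)) \<cdot>
        associator M (w, on_obj (tensor M) (x, y), z) \<cdot>
        on_arr (tensor M) (associator M (w, x, y), Ident C z)"
    and triangle: "x \<in> Obj C \<Longrightarrow> y \<in> Obj C \<Longrightarrow>
      on_arr (tensor M) (Ident C x, left_unitor M y) \<cdot> associator M (x, unit_obj M, y) =
      on_arr (tensor M) (right_unitor M x, Ident C y)"

locale symmetric_monoidal_category = monoidal_category C M
  for C :: "('o, 'a) category_data" (structure)
    and M :: "('o, 'a, 'm) symmetric_monoidal_data_scheme" +
  assumes braiding_natural: "natural_isomorphism (C \<times>\<^sub>C C) C
      (tensor_functor M var1_of_2 var2_of_2) (tensor_functor M var2_of_2 var1_of_2) (braiding M)"
    and symmetry: "x \<in> Obj C \<Longrightarrow> y \<in> Obj C \<Longrightarrow>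
      braiding M (y, x) \<cdot> braiding M (x, y) = Ident C (on_obj (tensor M) (x, y))"
    and hexagon: "x \<in> Obj C \<Longrightarrow> y \<in> Obj C \<Longrightarrow> z \<in> Obj C \<Longrightarrow>
      associator M (y, z, x) \<cdot> braiding M (x, on_obj (tensor M) (y, z)) \<cdot> associator M (x, y, z) =
      on_arr (tensor M) (Ident C y, braiding M (x, z)) \<cdot>
        associator M (y, x, z) \<cdot>
        on_arr (tensor M) (braiding M (x, y), Ident C z)"

text \<open>
  Having negative objects is extra structure that a distributive category may or may not carry;
  \<open>negative = None\<close> means that no negative functor is given.
\<close>

record ('o, 'a) distributive_data =
  underlying :: "('o, 'a) category_data"
  additive :: "('o, 'a) symmetric_monoidal_data"
  multiplicative :: "('o, 'a) monoidal_data"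
  negative :: "('o, 'a, 'o, 'a) functor_data option"

definition sum_functor ::
    "('p, 'b, 'o, 'a) functor_data \<Rightarrow> ('o, 'a) distributive_data \<Rightarrow>
     ('p, 'b, 'o, 'a) functor_data \<Rightarrow> ('p, 'b, 'o, 'a) functor_data"
    (\<open>(_ \<oplus>[_]/ _)\<close> [65, 0, 66] 65) where
  "F \<oplus>[D] G = tensor_functor (additive D) F G"

definition prod_functor ::
    "('p, 'b, 'o, 'a) functor_data \<Rightarrow> ('o, 'a) distributive_data \<Rightarrow>
     ('p, 'b, 'o, 'a) functor_data \<Rightarrow> ('p, 'b, 'o, 'a) functor_data"
    (\<open>(_ \<otimes>[_]/ _)\<close> [70, 0, 71] 70) where
  "F \<otimes>[D] G = tensor_functor (multiplicative D) F G"

definition negative_functor ::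
    "('o, 'a) distributive_data \<Rightarrow> ('o, 'a, 'o, 'a) functor_data \<Rightarrow> bool" where
  "negative_functor D N \<longleftrightarrow>
     category_functor (underlying D) (underlying D) N \<and>
     naturally_isomorphic (underlying D \<times>\<^sub>C underlying D) (underlying D)
       (N \<circ>\<^sub>F (var1_of_2 \<oplus>[D] var2_of_2)) ((N \<circ>\<^sub>F var1_of_2) \<oplus>[D] (N \<circ>\<^sub>F var2_of_2)) \<and>
     isomorphic_objects (underlying D)
       (on_obj N (unit_obj (additive D))) (unit_obj (additive D)) \<and>
     naturally_isomorphic (underlying D) (underlying D) (N \<circ>\<^sub>F N) id_functor"

locale distributive_category =
  fixes D :: "('o, 'a) distributive_data"
  assumes additive_symmetric_monoidal: "symmetric_monoidal_category (underlying D) (additive D)"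
    and multiplicative_monoidal: "monoidal_category (underlying D) (multiplicative D)"
    and left_distributive:
      "naturally_isomorphic (underlying D \<times>\<^sub>C underlying D \<times>\<^sub>C underlying D) (underlying D)
        (var1_of_3 \<otimes>[D] (var2_of_3 \<oplus>[D] var3_of_3))
        ((var1_of_3 \<otimes>[D] var2_of_3) \<oplus>[D] (var1_of_3 \<otimes>[D] var3_of_3))"
    and right_distributive:
      "naturally_isomorphic (underlying D \<times>\<^sub>C underlying D \<times>\<^sub>C underlying D) (underlying D)
        ((var1_of_3 \<oplus>[D] var2_of_3) \<otimes>[D] var3_of_3)
        ((var1_of_3 \<otimes>[D] var3_of_3) \<oplus>[D] (var2_of_3 \<otimes>[D] var3_of_3))"
    and negative_is_negative_functor: "negative D = Some N \<Longrightarrow> negative_functor D N"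

text \<open>The isomorphisms below are only required to exist; no coherence conditions are imposed on them.\<close>

locale additive_functor = distributive_category D
  for D :: "('o, 'a) distributive_data" +
  fixes P :: "('o, 'a, 'o, 'a) functor_data"
  assumes is_functor: "category_functor (underlying D) (underlying D) P"
    and preserves_sum: "naturally_isomorphic (underlying D \<times>\<^sub>C underlying D) (underlying D)
      (P \<circ>\<^sub>F (var1_of_2 \<oplus>[D] var2_of_2)) ((P \<circ>\<^sub>F var1_of_2) \<oplus>[D] (P \<circ>\<^sub>F var2_of_2))"
    and preserves_negative: "negative D = Some N \<Longrightarrow>
      naturally_isomorphic (underlying D) (underlying D) (P \<circ>\<^sub>F N) (N \<circ>\<^sub>F P)"

locale bimonoidal_functor = additive_functor D P
  for D :: "('o, 'a) distributive_data" and P :: "('o, 'a, 'o, 'a) functor_data" +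
  assumes preserves_prod: "naturally_isomorphic (underlying D \<times>\<^sub>C underlying D) (underlying D)
      (P \<circ>\<^sub>F (var1_of_2 \<otimes>[D] var2_of_2)) ((P \<circ>\<^sub>F var1_of_2) \<otimes>[D] (P \<circ>\<^sub>F var2_of_2))"

locale rota_baxter_category_weight_minus_one = additive_functor D P
  for D :: "('o, 'a) distributive_data" and P :: "('o, 'a, 'o, 'a) functor_data" +
  assumes rota_baxter: "naturally_isomorphic (underlying D \<times>\<^sub>C underlying D) (underlying D)
      (((P \<circ>\<^sub>F var1_of_2) \<otimes>[D] (P \<circ>\<^sub>F var2_of_2)) \<oplus>[D] (P \<circ>\<^sub>F (var1_of_2 \<otimes>[D] var2_of_2)))
      ((P \<circ>\<^sub>F ((P \<circ>\<^sub>F var1_of_2) \<otimes>[D] var2_of_2)) \<oplus>[D] (P \<circ>\<^sub>F (var1_of_2 \<otimes>[D] (P \<circ>\<^sub>F var2_of_2))))"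

end

theory Submission
  imports Defs
begin

text \<open>
  Since \<open>P\<close> is multiplicative and idempotent up to natural isomorphism, the three functors
  \<open>P(P(x) \<otimes> y)\<close>, \<open>P(x \<otimes> P(y))\<close> and \<open>P(x \<otimes> y)\<close> are all naturally isomorphic to
  \<open>P(x) \<otimes> P(y)\<close>.  Hence the two sides of the Rota-Baxter relation agree summand by summand.
\<close>

section \<open>Functors between product categories\<close>

lemma hom_product_category:
  "(f, g) \<in> hom (B \<times>\<^sub>C C) (x, y) (x', y') \<longleftrightarrow> f \<in> hom B x x' \<and> g \<in> hom C y y'"
  by (auto simp: hom_def product_category_def)

text \<open>Arrows of a product are destructed here even when the endpoints \<open>x\<close>,
  \<open>y\<close> are variables rather than explicit pairs, the case that
  \<open>hom_product_category\<close> alone does not match.\<close>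

lemma hom_product_categoryE:
  assumes "h \<in> hom (B \<times>\<^sub>C C) x y"
  obtains f g where "h = (f, g)" "f \<in> hom B (fst x) (fst y)" "g \<in> hom C (snd x) (snd y)"
  using assms by (cases h; cases x; cases y) (auto simp: hom_product_category)

lemma Obj_product_category: "Obj (B \<times>\<^sub>C C) = Obj B \<times> Obj C"
  by (simp add: product_category_def)

lemma Ident_product_category: "Ident (B \<times>\<^sub>C C) (x, y) = (Ident B x, Ident C y)"
  by (simp add: product_category_def)

lemma Comp_product_category: "(g, g') \<cdot>\<^bsub>B \<times>\<^sub>C C\<^esub> (f, f') = (g \<cdot>\<^bsub>B\<^esub> f, g' \<cdot>\<^bsub>C\<^esub> f')"
  by (simp add: product_category_def)

lemmas product_category_simps =
  hom_product_category Obj_product_category Ident_product_category Comp_product_category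

lemma category_product:
  assumes "category B" and "category C"
  shows "category (B \<times>\<^sub>C C)"
proof -
  interpret B: category B by fact
  interpret C: category C by fact
  show ?thesis
  proof
    show "Dom (B \<times>\<^sub>C C) f \<in> Obj (B \<times>\<^sub>C C)" "Cod (B \<times>\<^sub>C C) f \<in> Obj (B \<times>\<^sub>C C)"
      if "f \<in> Arr (B \<times>\<^sub>C C)" for f
      using that by (auto simp: product_category_def
        intro: B.Dom_closed C.Dom_closed B.Cod_closed C.Cod_closed)
  qed (auto simp: product_category_simps elim!: hom_product_categoryE
        intro: B.Ident_hom C.Ident_hom B.Comp_hom C.Comp_hom B.Comp_Ident C.Comp_Ident
          B.Ident_Comp C.Ident_Comp B.Comp_assoc C.Comp_assoc)
qed

section \<open>Composites, pairings and projections are functors\<close>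

lemma category_functor_comp:
  assumes "category_functor A B F" and "category_functor B C G"
  shows "category_functor A C (G \<circ>\<^sub>F F)"
proof -
  interpret F: category_functor A B F by fact
  interpret G: category_functor B C G by fact
  show ?thesis
    by unfold_locales
      (auto simp: comp_functor_def F.on_arr_Ident G.on_arr_Ident F.on_obj_closed G.on_obj_closed
        F.on_arr_Comp intro: F.on_arr_hom G.on_arr_hom G.on_arr_Comp)
qed

lemma category_functor_pair:
  assumes "category_functor A B F" and "category_functor A C G"
  shows "category_functor A (B \<times>\<^sub>C C) (pair_functor F G)"
proof -
  interpret F: category_functor A B F by fact
  interpret G: category_functor A C G by fact
  \<comment> \<open>This discharges the codomain part of \<open>category_functor\<close>, so that
    \<open>unfold_locales\<close> leaves only the four functor laws.\<close>
  interpret BC: category "B \<times>\<^sub>C C"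
    by (rule category_product[OF F.C.category_axioms G.C.category_axioms])
  show ?thesis
    by unfold_locales
      (auto simp: pair_functor_def product_category_simps F.on_arr_Ident G.on_arr_Ident
        F.on_obj_closed G.on_obj_closed F.on_arr_Comp G.on_arr_Comp
        intro: F.on_arr_hom G.on_arr_hom)
qed

lemma category_functor_fst:
  assumes "category B" and "category C"
  shows "category_functor (B \<times>\<^sub>C C) B fst_functor"
proof -
  interpret B: category B by fact
  interpret BC: category "B \<times>\<^sub>C C" by (rule category_product[OF assms])
  show ?thesis
    by unfold_locales
      (auto simp: fst_functor_def product_category_simps elim!: hom_product_categoryE)
qed

lemma category_functor_snd:
  assumes "category B" and "category C"
  shows "category_functor (B \<times>\<^sub>C C) C snd_functor"
proof -
  interpret C: category C by fact
  interpret BC: category "B \<times>\<^sub>C C" by (rule category_product[OF assms])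
  show ?thesis
    by unfold_locales
      (auto simp: snd_functor_def product_category_simps elim!: hom_product_categoryE)
qed

text \<open>This law and the next four are equalities of records, stronger than natural
  isomorphisms, so the simplifier can rewrite functor expressions with them.\<close>

lemma comp_functor_assoc: "(H \<circ>\<^sub>F G) \<circ>\<^sub>F F = H \<circ>\<^sub>F (G \<circ>\<^sub>F F)"
  by (simp add: comp_functor_def)

lemma fst_functor_comp_pair: "fst_functor \<circ>\<^sub>F pair_functor F G = F"
  by (simp add: comp_functor_def fst_functor_def pair_functor_def)

lemma snd_functor_comp_pair: "snd_functor \<circ>\<^sub>F pair_functor F G = G"
  by (simp add: comp_functor_def snd_functor_def pair_functor_def)

lemma pair_functor_comp: "pair_functor F G \<circ>\<^sub>F H = pair_functor (F \<circ>\<^sub>F H) (G \<circ>\<^sub>F H)"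
  by (simp add: comp_functor_def pair_functor_def)

text \<open>Precomposition acts as substitution: it passes through the tensor down to the
  projections, which are the variables of an expression.\<close>

lemma tensor_functor_comp: "tensor_functor M F G \<circ>\<^sub>F H = tensor_functor M (F \<circ>\<^sub>F H) (G \<circ>\<^sub>F H)"
  by (simp add: tensor_functor_def comp_functor_assoc pair_functor_comp)

section \<open>Calculus of natural isomorphisms\<close>

lemma isomorphismI:
  assumes "f \<in> hom C x y" "g \<in> hom C y x" "g \<cdot>\<^bsub>C\<^esub> f = Ident C x" "f \<cdot>\<^bsub>C\<^esub> g = Ident C y"
  shows "isomorphism C f"
  using assms by (auto simp: isomorphism_def hom_def)

lemma isomorphismE:
  assumes "isomorphism C f" "f \<in> hom C x y"
  obtains g where "g \<in> hom C y x" "g \<cdot>\<^bsub>C\<^esub> f = Ident C x" "f \<cdot>\<^bsub>C\<^esub> g = Ident C y"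
  using assms by (auto simp: isomorphism_def hom_def)

lemma (in category) isomorphism_Ident: "x \<in> Obj C \<Longrightarrow> isomorphism C (Ident C x)"
  by (rule isomorphismI[where g = "Ident C x"]) (auto intro: Ident_hom Comp_Ident)

lemma (in category) isomorphism_Comp:
  assumes f: "f \<in> hom C x y" "isomorphism C f" and g: "g \<in> hom C y z" "isomorphism C g"
  shows "isomorphism C (g \<cdot> f)"
proof -
  obtain f' where f': "f' \<in> hom C y x" "f' \<cdot> f = Ident C x" "f \<cdot> f' = Ident C y"
    using f by (elim isomorphismE)
  obtain g' where g': "g' \<in> hom C z y" "g' \<cdot> g = Ident C y" "g \<cdot> g' = Ident C z"
    using g by (elim isomorphismE)
  \<comment> \<open>The inverse of a composite is the composite of the inverses in reverse order;
    associativity exposes the inner pair, which cancels first.\<close>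
  have 1: "(f' \<cdot> g') \<cdot> (g \<cdot> f) = Ident C x"
    using Comp_assoc[OF Comp_hom[OF f(1) g(1)] g'(1) f'(1)] Comp_assoc[OF f(1) g(1) g'(1)]
    by (simp add: f' g' Ident_Comp[OF f(1)])
  have 2: "(g \<cdot> f) \<cdot> (f' \<cdot> g') = Ident C z"
    using Comp_assoc[OF Comp_hom[OF g'(1) f'(1)] f(1) g(1)] Comp_assoc[OF g'(1) f'(1) f(1)]
    by (simp add: f' g' Ident_Comp[OF g'(1)])
  show ?thesis
    by (rule isomorphismI[OF _ _ 1 2]) (use f g f' g' Comp_hom in blast)+
qed

lemma (in category_functor) isomorphism_on_arr:
  assumes "f \<in> hom B x y" "isomorphism B f"
  shows "isomorphism C (on_arr F f)"
proof -
  obtain g where g: "g \<in> hom B y x" "g \<cdot>\<^bsub>B\<^esub> f = Ident B x" "f \<cdot>\<^bsub>B\<^esub> g = Ident B y"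
    using assms by (elim isomorphismE)
  have "x \<in> Obj B" "y \<in> Obj B"
    using assms B.Dom_closed B.Cod_closed by (auto simp: hom_def)
  then show ?thesis
    by (intro isomorphismI[where g = "on_arr F g"])
      (use assms g in \<open>auto simp: on_arr_Ident simp flip: on_arr_Comp intro: on_arr_hom\<close>)
qed

lemma isomorphism_product_category:
  assumes "isomorphism B f" "isomorphism C g"
  shows "isomorphism (B \<times>\<^sub>C C) (f, g)"
  using assms by (force simp: isomorphism_def product_category_def hom_def)

section \<open>Natural isomorphism is an equivalence relation\<close>

lemma naturally_isomorphic_refl:
  assumes "category_functor B C F"
  shows "naturally_isomorphic B C F F"
proof -
  interpret F: category_functor B C F by fact
  have "natural_isomorphism B C F F (\<lambda>x. Ident C (on_obj F x))"
    by unfold_locales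
      (auto simp: F.C.isomorphism_Ident F.C.Ident_hom F.on_obj_closed
        F.C.Ident_Comp[OF F.on_arr_hom] F.C.Comp_Ident[OF F.on_arr_hom])
  then show ?thesis
    by (auto simp: naturally_isomorphic_def)
qed

lemma naturally_isomorphic_sym:
  assumes "naturally_isomorphic B C F G"
  shows "naturally_isomorphic B C G F"
proof -
  obtain \<tau> where "natural_isomorphism B C F G \<tau>"
    using assms by (auto simp: naturally_isomorphic_def)
  then interpret natural_isomorphism B C F G \<tau> .
  \<comment> \<open>An inverse of each component is chosen; \<open>\<sigma>\<close> is the resulting
    choice function.\<close>
  have "\<forall>x \<in> Obj B. \<exists>g. g \<in> hom C (on_obj G x) (on_obj F x) \<and>
      g \<cdot>\<^bsub>C\<^esub> \<tau> x = Ident C (on_obj F x) \<and> \<tau> x \<cdot>\<^bsub>C\<^esub> g = Ident C (on_obj G x)"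
    by (meson component_hom component_iso isomorphismE)
  then obtain \<sigma> where \<sigma>: "x \<in> Obj B \<Longrightarrow> \<sigma> x \<in> hom C (on_obj G x) (on_obj F x)"
      "x \<in> Obj B \<Longrightarrow> \<sigma> x \<cdot>\<^bsub>C\<^esub> \<tau> x = Ident C (on_obj F x)"
      "x \<in> Obj B \<Longrightarrow> \<tau> x \<cdot>\<^bsub>C\<^esub> \<sigma> x = Ident C (on_obj G x)" for x
    by metis
  have "natural_isomorphism B C G F \<sigma>"
  proof
    show "isomorphism C (\<sigma> x)" if "x \<in> Obj B" for x
      using isomorphismI[OF \<sigma>(1) component_hom \<sigma>(3,2)] that by blast
  next
    fix f x y assume f: "f \<in> hom B x y"
    then have [simp]: "x \<in> Obj B" "y \<in> Obj B"
      using F.B.Dom_closed F.B.Cod_closed by (auto simp: hom_def)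
    note Ff = F.on_arr_hom[OF f] and Gf = G.on_arr_hom[OF f]
    note \<sigma>x = \<sigma>(1)[of x, simplified] and \<sigma>y = \<sigma>(1)[of y, simplified]
      and \<tau>x = component_hom[of x, simplified] and \<tau>y = component_hom[of y, simplified]
    \<comment> \<open>Naturality of \<open>\<sigma>\<close> comes from that of
      \<open>\<tau>\<close>: insert the identity \<open>\<tau> x\<close> after
      \<open>\<sigma> x\<close>, move \<open>\<tau>\<close> across the square, and cancel
      \<open>\<sigma> y\<close> against \<open>\<tau> y\<close>.\<close>
    have "\<sigma> y \<cdot>\<^bsub>C\<^esub> on_arr G f = \<sigma> y \<cdot>\<^bsub>C\<^esub> (on_arr G f \<cdot>\<^bsub>C\<^esub> (\<tau> x \<cdot>\<^bsub>C\<^esub> \<sigma> x))"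
      using Gf by (simp add: \<sigma>(3) F.C.Comp_Ident)
    also have "\<dots> = \<sigma> y \<cdot>\<^bsub>C\<^esub> ((\<tau> y \<cdot>\<^bsub>C\<^esub> on_arr F f) \<cdot>\<^bsub>C\<^esub> \<sigma> x)"
      by (simp add: naturality[OF f] F.C.Comp_assoc[OF \<sigma>x \<tau>x Gf])
    also have "\<dots> = (\<sigma> y \<cdot>\<^bsub>C\<^esub> \<tau> y) \<cdot>\<^bsub>C\<^esub> (on_arr F f \<cdot>\<^bsub>C\<^esub> \<sigma> x)"
      by (simp add: F.C.Comp_assoc[OF \<sigma>x Ff \<tau>y]
          F.C.Comp_assoc[OF F.C.Comp_hom[OF \<sigma>x Ff] \<tau>y \<sigma>y])
    also have "\<dots> = on_arr F f \<cdot>\<^bsub>C\<^esub> \<sigma> x"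
      by (simp add: \<sigma>(2) F.C.Ident_Comp[OF F.C.Comp_hom[OF \<sigma>x Ff]])
    finally show "\<sigma> y \<cdot>\<^bsub>C\<^esub> on_arr G f = on_arr F f \<cdot>\<^bsub>C\<^esub> \<sigma> x" .
  qed (rule \<sigma>(1))
  then show ?thesis
    by (auto simp: naturally_isomorphic_def)
qed

lemma naturally_isomorphic_trans [trans]:
  assumes "naturally_isomorphic B C F G" and "naturally_isomorphic B C G H"
  shows "naturally_isomorphic B C F H"
proof -
  obtain \<sigma> \<tau> where "natural_isomorphism B C F G \<sigma>" and "natural_isomorphism B C G H \<tau>"
    using assms by (auto simp: naturally_isomorphic_def)
  then interpret \<sigma>: natural_isomorphism B C F G \<sigma> + \<tau>: natural_isomorphism B C G H \<tau> .
  have "natural_isomorphism B C F H (\<lambda>x. \<tau> x \<cdot>\<^bsub>C\<^esub> \<sigma> x)"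
  proof
    fix x assume "x \<in> Obj B"
    then show "\<tau> x \<cdot>\<^bsub>C\<^esub> \<sigma> x \<in> hom C (on_obj F x) (on_obj H x)"
        and "isomorphism C (\<tau> x \<cdot>\<^bsub>C\<^esub> \<sigma> x)"
      using \<sigma>.F.C.Comp_hom \<sigma>.F.C.isomorphism_Comp
        \<sigma>.component_hom \<tau>.component_hom \<sigma>.component_iso \<tau>.component_iso by blast+
  next
    fix f x y assume f: "f \<in> hom B x y"
    then have "x \<in> Obj B" "y \<in> Obj B"
      using \<sigma>.F.B.Dom_closed \<sigma>.F.B.Cod_closed by (auto simp: hom_def)
    \<comment> \<open>The naturality squares of \<open>\<sigma>\<close> and \<open>\<tau>\<close>
      are pasted along \<open>on_arr G f\<close>; the three instances of associativity supply the
      bracketings for this.\<close>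
    then show "(\<tau> y \<cdot>\<^bsub>C\<^esub> \<sigma> y) \<cdot>\<^bsub>C\<^esub> on_arr F f = on_arr H f \<cdot>\<^bsub>C\<^esub> (\<tau> x \<cdot>\<^bsub>C\<^esub> \<sigma> x)"
      using \<sigma>.F.C.Comp_assoc[OF \<sigma>.F.on_arr_hom[OF f] \<sigma>.component_hom \<tau>.component_hom]
        \<sigma>.F.C.Comp_assoc[OF \<sigma>.component_hom \<sigma>.G.on_arr_hom[OF f] \<tau>.component_hom]
        \<sigma>.F.C.Comp_assoc[OF \<sigma>.component_hom \<tau>.component_hom \<tau>.G.on_arr_hom[OF f]]
      by (simp add: \<sigma>.naturality[OF f] flip: \<tau>.naturality[OF f])
  qed
  then show ?thesis
    by (auto simp: naturally_isomorphic_def)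
qed

section \<open>Natural isomorphism is a congruence for composition, pairing and tensor\<close>

lemma naturally_isomorphic_comp_left:
  assumes "naturally_isomorphic A B F F'" and "category_functor B C H"
  shows "naturally_isomorphic A C (H \<circ>\<^sub>F F) (H \<circ>\<^sub>F F')"
proof -
  obtain \<tau> where "natural_isomorphism A B F F' \<tau>"
    using assms by (auto simp: naturally_isomorphic_def)
  then interpret natural_isomorphism A B F F' \<tau> .
  interpret H: category_functor B C H by fact
  interpret HF: category_functor A C "H \<circ>\<^sub>F F"
    by (rule category_functor_comp) unfold_locales
  interpret HF': category_functor A C "H \<circ>\<^sub>F F'"
    by (rule category_functor_comp) unfold_locales
  \<comment> \<open>Whiskering by \<open>H\<close>: functors preserve isomorphisms and commuting
    squares, so the image of \<open>\<tau>\<close> is again a natural isomorphism.\<close>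
  have "natural_isomorphism A C (H \<circ>\<^sub>F F) (H \<circ>\<^sub>F F') (\<lambda>x. on_arr H (\<tau> x))"
  proof
    fix f x y assume f: "f \<in> hom A x y"
    then have "x \<in> Obj A" "y \<in> Obj A"
      using F.B.Dom_closed F.B.Cod_closed by (auto simp: hom_def)
    then show "on_arr H (\<tau> y) \<cdot>\<^bsub>C\<^esub> on_arr (H \<circ>\<^sub>F F) f = on_arr (H \<circ>\<^sub>F F') f \<cdot>\<^bsub>C\<^esub> on_arr H (\<tau> x)"
      using H.on_arr_Comp[OF F.on_arr_hom[OF f] component_hom[of y]]
        H.on_arr_Comp[OF component_hom[of x] G.on_arr_hom[OF f]]
      by (simp add: comp_functor_def naturality[OF f])
  qed (auto simp: comp_functor_def
      intro: H.on_arr_hom component_hom component_iso H.isomorphism_on_arr)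
  then show ?thesis
    by (auto simp: naturally_isomorphic_def)
qed

text \<open>Reindexing the components along \<open>H\<close> substitutes functors for the variables
  of a given natural isomorphism.\<close>

lemma naturally_isomorphic_comp_right:
  assumes "naturally_isomorphic B C F F'" and "category_functor A B H"
  shows "naturally_isomorphic A C (F \<circ>\<^sub>F H) (F' \<circ>\<^sub>F H)"
proof -
  obtain \<tau> where "natural_isomorphism B C F F' \<tau>"
    using assms by (auto simp: naturally_isomorphic_def)
  then interpret natural_isomorphism B C F F' \<tau> .
  interpret H: category_functor A B H by fact
  interpret FH: category_functor A C "F \<circ>\<^sub>F H"
    by (rule category_functor_comp) unfold_locales
  interpret F'H: category_functor A C "F' \<circ>\<^sub>F H"
    by (rule category_functor_comp) unfold_locales
  have "natural_isomorphism A C (F \<circ>\<^sub>F H) (F' \<circ>\<^sub>F H) (\<lambda>x. \<tau> (on_obj H x))"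
    by unfold_locales
      (auto simp: comp_functor_def naturality[OF H.on_arr_hom] component_hom component_iso
        H.on_obj_closed)
  then show ?thesis
    by (auto simp: naturally_isomorphic_def)
qed

lemma naturally_isomorphic_pair:
  assumes "naturally_isomorphic A B F F'" and "naturally_isomorphic A C G G'"
  shows "naturally_isomorphic A (B \<times>\<^sub>C C) (pair_functor F G) (pair_functor F' G')"
proof -
  obtain \<sigma> \<tau> where "natural_isomorphism A B F F' \<sigma>" and "natural_isomorphism A C G G' \<tau>"
    using assms by (auto simp: naturally_isomorphic_def)
  then interpret \<sigma>: natural_isomorphism A B F F' \<sigma> + \<tau>: natural_isomorphism A C G G' \<tau> .
  interpret FG: category_functor A "B \<times>\<^sub>C C" "pair_functor F G"
    by (rule category_functor_pair) unfold_locales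
  interpret F'G': category_functor A "B \<times>\<^sub>C C" "pair_functor F' G'"
    by (rule category_functor_pair) unfold_locales
  have "natural_isomorphism A (B \<times>\<^sub>C C) (pair_functor F G) (pair_functor F' G')
      (\<lambda>x. (\<sigma> x, \<tau> x))"
    by unfold_locales
      (auto simp: pair_functor_def product_category_simps \<sigma>.component_hom \<tau>.component_hom
        \<sigma>.naturality \<tau>.naturality \<sigma>.component_iso \<tau>.component_iso isomorphism_product_category)
  then show ?thesis
    by (auto simp: naturally_isomorphic_def)
qed

text \<open>The tensor is a functor on the product category, so whiskering with it carries a pair of
  natural isomorphisms to one between the tensors. Each factor can thus be replaced
  separately.\<close>

lemma (in monoidal_category) naturally_isomorphic_tensor:
  assumes "naturally_isomorphic B C F F'" and "naturally_isomorphic B C G G'"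
  shows "naturally_isomorphic B C (tensor_functor M F G) (tensor_functor M F' G')"
  unfolding tensor_functor_def
  by (rule naturally_isomorphic_comp_left[OF naturally_isomorphic_pair[OF assms] tensor_is_functor])

section \<open>The Rota-Baxter relation\<close>

text \<open>Multiplicativity of \<open>P\<close> is given for the variables \<open>x\<close>,
  \<open>y\<close> only; precomposing with \<open>pair_functor F G\<close> substitutes
  \<open>F\<close> and \<open>G\<close> for them.\<close>

lemma (in bimonoidal_functor) preserves_prod_functor:
  assumes "category_functor B (underlying D) F" and "category_functor B (underlying D) G"
  shows "naturally_isomorphic B (underlying D) (P \<circ>\<^sub>F (F \<otimes>[D] G)) ((P \<circ>\<^sub>F F) \<otimes>[D] (P \<circ>\<^sub>F G))"
  using naturally_isomorphic_comp_right[OF preserves_prod category_functor_pair[OF assms]]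
  by (simp add: prod_functor_def tensor_functor_comp comp_functor_assoc
      fst_functor_comp_pair snd_functor_comp_pair)

theorem theorem4p1:
  fixes D :: "('o, 'a) distributive_data"
    and P :: "('o, 'a, 'o, 'a) functor_data"
  assumes "distributive_category D"
    and "bimonoidal_functor D P"
    and "naturally_isomorphic (underlying D) (underlying D) (P \<circ>\<^sub>F P) P"
  shows "rota_baxter_category_weight_minus_one D P"
proof -
  interpret bimonoidal_functor D P by fact
  let ?C = "underlying D"
  let ?x = "var1_of_2 :: ('o \<times> 'o, 'a \<times> 'a, 'o, 'a) functor_data"
  let ?y = "var2_of_2 :: ('o \<times> 'o, 'a \<times> 'a, 'o, 'a) functor_data"
  interpret add: symmetric_monoidal_category ?C "additive D"
    by (rule additive_symmetric_monoidal)
  interpret mult: monoidal_category ?C "multiplicative D"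
    by (rule multiplicative_monoidal)
  have x: "category_functor (?C \<times>\<^sub>C ?C) ?C ?x" and y: "category_functor (?C \<times>\<^sub>C ?C) ?C ?y"
    by (rule category_functor_fst category_functor_snd; rule add.category_axioms)+
  have Px: "category_functor (?C \<times>\<^sub>C ?C) ?C (P \<circ>\<^sub>F ?x)"
    and Py: "category_functor (?C \<times>\<^sub>C ?C) ?C (P \<circ>\<^sub>F ?y)"
    using x y is_functor by (blast intro: category_functor_comp)+
  \<comment> \<open>Since \<open>\<circ>\<^sub>F\<close> nests to the right, the first functor is
    \<open>P\<close> applied to \<open>P \<circ>\<^sub>F F\<close>. This is the shape that
    \<open>preserves_prod_functor\<close> yields for a factor already under
    \<open>P\<close>.\<close>
  have PP: "naturally_isomorphic (?C \<times>\<^sub>C ?C) ?C (P \<circ>\<^sub>F P \<circ>\<^sub>F F) (P \<circ>\<^sub>F F)"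
    if "category_functor (?C \<times>\<^sub>C ?C) ?C F" for F
    using naturally_isomorphic_comp_right[OF assms(3) that] by (simp add: comp_functor_assoc)
  \<comment> \<open>The chain is P(P(x) * y) to P(P(x)) * P(y) to P(x) * P(y), where * is the
    product: idempotence acts on the first factor, reflexivity on the second.\<close>
  have left: "naturally_isomorphic (?C \<times>\<^sub>C ?C) ?C
      (P \<circ>\<^sub>F ((P \<circ>\<^sub>F ?x) \<otimes>[D] ?y)) ((P \<circ>\<^sub>F ?x) \<otimes>[D] (P \<circ>\<^sub>F ?y))"
    by (rule naturally_isomorphic_trans[OF preserves_prod_functor[OF Px y]])
      (unfold prod_functor_def, intro mult.naturally_isomorphic_tensor PP x
        naturally_isomorphic_refl Py)
  \<comment> \<open>The mirror image: here idempotence acts on the second factor.\<close>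
  have right: "naturally_isomorphic (?C \<times>\<^sub>C ?C) ?C
      (P \<circ>\<^sub>F (?x \<otimes>[D] (P \<circ>\<^sub>F ?y))) ((P \<circ>\<^sub>F ?x) \<otimes>[D] (P \<circ>\<^sub>F ?y))"
    by (rule naturally_isomorphic_trans[OF preserves_prod_functor[OF x Py]])
      (unfold prod_functor_def, intro mult.naturally_isomorphic_tensor PP y
        naturally_isomorphic_refl Px)
  show ?thesis
  \<comment> \<open>A bimonoidal functor is additive, including its compatibility with a negative
    functor when one is given; only the Rota-Baxter isomorphism remains.\<close>
  proof
    show "naturally_isomorphic (?C \<times>\<^sub>C ?C) ?C
      (((P \<circ>\<^sub>F ?x) \<otimes>[D] (P \<circ>\<^sub>F ?y)) \<oplus>[D] (P \<circ>\<^sub>F (?x \<otimes>[D] ?y)))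
      ((P \<circ>\<^sub>F ((P \<circ>\<^sub>F ?x) \<otimes>[D] ?y)) \<oplus>[D] (P \<circ>\<^sub>F (?x \<otimes>[D] (P \<circ>\<^sub>F ?y))))"
      \<comment> \<open>The first summands are matched by \<open>left\<close> reversed. For the
        second summands, P(x * y) goes to P(x) * P(y) and then, by \<open>right\<close> reversed, to
        P(x * P(y)).\<close>
      unfolding sum_functor_def
      by (intro add.naturally_isomorphic_tensor naturally_isomorphic_sym[OF left]
        naturally_isomorphic_trans[OF preserves_prod naturally_isomorphic_sym[OF right]])
  qed
qed

end
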